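(* Let $\mathbb{X}$ be a linearly ordered radicable commutative idempotent semifield with zero $\mathbb{0}$ and identity $\mathbb{1}$. Let $\bm{A},\bm{B}\in\mathbb{X}^{n\times n}$, $\bm{C}\in\mathbb{X}^{m\times n}$, $\bm{g}\in\mathbb{X}^{n}$, $\bm{h}\in\mathbb{X}^{m}$. Suppose that $\bm{A}$ has spectral radius $\lambda>\mathbb{0}$, that $\bm{C}$ is column-regular, that $\bm{h}$ is regular, and that $\mathrm{Tr}(\bm{B})\oplus\bm{h}^{-}\bm{C}\bm{B}^{\ast}\bm{g}\leq\mathbb{1}$. Consider the problem $$ \text{minimize}\quad \bm{x}^{-}\bm{A}\bm{x}\qquad\text{subject to}\quad \bm{B}\bm{x}\oplus\bm{g}\leq\bm{x},\quad \bm{C}\bm{x}\leq\bm{h}, $$ over regular vectors $\bm{x}\in\mathbb{X}^{n}$. Define the scalar $$ \theta=\bigoplus_{k=1}^{n}\ \bigoplus_{0\leq i_{0}+i_{1}+\cdots+i_{k}\leq n-k}\mathrm{tr}^{1/k}\bigl(\bm{B}^{i_{0}}(\bm{A}\bm{B}^{i_{1}}\cdots\bm{A}\bm{B}^{i_{k}})(\bm{I}\oplus\bm{g}\bm{h}^{-}\bm{C})\bigr), $$ where the inner sum is over all nonnegative integers $i_0,i_1,\ldots,i_k$ satisfying the indicated inequality. Then the minimum in the problem is equal to $\theta$, and a regular vector $\bm{x}$ satisfying the constraints attains it if and only if $$ \bm{x}=(\theta^{-1}\bm{A}\oplus\bm{B})^{\ast}\bm{u} \quad\text{for some regular vector }\bm{u}\in\mathbb{X}^n\text{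 with}\quad \bm{g}\leq\bm{u}\leq\bigl(\bm{h}^{-}\bm{C}(\theta^{-1}\bm{A}\oplus\bm{B})^{\ast}\bigr)^{-}. $$ Moreover, every vector of this form is a regular feasible vector attaining the minimum.
   Context: A commutative idempotent semifield $\langle\mathbb{X},\mathbb{0},\mathbb{1},\oplus,\otimes\rangle$ is a commutative semiring with zero $\mathbb{0}$ and identity $\mathbb{1}$ in which $x\oplus x=x$ for all $x$ and every $x\neq\mathbb{0}$ has a multiplicative inverse $x^{-1}$. The order is $x\leq y\iff x\oplus y=y$; it is assumed to be total (linearly ordered), and all inequalities and minima refer to it. Note $x\geq\mathbb{0}$ for all $x$. Radicable means that rational powers are defined: for $x\neq\mathbb{0}$ and integer $p\geq1$ there is $x^{1/p}$ with $(x^{1/p})^p=x$; also $\mathbb{0}^{1/p}=\mathbb{0}$. The multiplication sign is omitted. Matrix addition, multiplication and scalar multiplication are defined by the usual formulas using $\oplus,\otimes$; inequalities between matrices or vectors are entrywise. $\bm{I}$ is the identity matrix ($\mathbb{1}$ on the diagonal, $\mathbb{0}$ elsewhere), $\bm{A}^0=\bm{I}$, $\bm{A}^p=\bm{A}^{p-1}\bm{A}$. A matrix is column-regular if no column consists entirely of $\mathbb{0}$; a vector is regular if all its components are different from $\mathbb{0}$. For a nonzero column (resp. row) vector $\bm{x}=(x_i)$, the multiplicative conjugate transpose $\bm{x}^{-}$ is the row (resp. column) vector with entries $x_i^{-1}$ if $x_i>\mathbb{0}$ and $\mathbb{0}$ otherwise. For $\bm{A}=(a_{ij})\in\mathbb{X}^{n\times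 n}$: $\mathrm{tr}\,\bm{A}=a_{11}\oplus\cdots\oplus a_{nn}$, and $\mathrm{tr}^{1/k}(\bm{A})$ denotes $(\mathrm{tr}\,\bm{A})^{1/k}$; $\mathrm{Tr}(\bm{A})=\mathrm{tr}\,\bm{A}\oplus\mathrm{tr}\,\bm{A}^2\oplus\cdots\oplus\mathrm{tr}\,\bm{A}^{n}$; $\bm{A}^{\ast}=\bm{I}\oplus\bm{A}\oplus\cdots\oplus\bm{A}^{n-1}$; the spectral radius of $\bm{A}$ is $\lambda=\mathrm{tr}\,\bm{A}\oplus\mathrm{tr}^{1/2}(\bm{A}^2)\oplus\cdots\oplus\mathrm{tr}^{1/n}(\bm{A}^{n})$ (the maximum eigenvalue of $\bm{A}$). *)

theory Defs
  imports "HOL-Analysis.Analysis"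
begin

section \<open>Linearly ordered radicable commutative idempotent semifields\<close>

text \<open>
  The semifield operations are the class operations \<open>+\<close>, \<open>*\<close>, \<open>0\<close>, \<open>1\<close>, so that \<open>sum\<close>, \<open>**\<close>,
  \<open>*v\<close>, \<open>v*\<close>, \<open>mat 1\<close> and \<open>trace\<close> are the idempotent-algebra operations.
  The value of \<open>inverse 0\<close> is left unspecified.
\<close>

class radicable_idem_semifield = comm_semiring_1 + inverse + linorder +
  assumes idem_add: "x + x = x"
    and idem_right_inverse: "x \<noteq> 0 \<Longrightarrow> x * inverse x = 1"
    and idem_divide_inverse: "x / y = x * inverse y"
    and idem_le_iff: "x \<le> y \<longleftrightarrow> x + y = y"
    and idem_radicable: "x \<noteq> 0 \<Longrightarrow> p \<ge> (1::nat) \<Longrightarrow> \<exists>y. y ^ p = x"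

definition rad :: "nat \<Rightarrow> 'a::radicable_idem_semifield \<Rightarrow> 'a" where
  "rad p x = (if x = 0 then 0 else (THE y. y ^ p = x))"

text \<open>The description in \<open>rad\<close> is proper: roots are unique.\<close>

lemma idem_mult_eq_0:
  fixes x y :: "'a::radicable_idem_semifield"
  assumes "x * y = 0" shows "x = 0 \<or> y = 0"
proof (rule ccontr)
  assume "\<not> ?thesis"
  then have "x \<noteq> 0" "y \<noteq> 0" by auto
  then have "(x * inverse x) * (y * inverse y) = 1"
    by (simp add: idem_right_inverse)
  then have "(x * y) * (inverse x * inverse y) = 1"
    by (simp add: ac_simps)
  with assms show False by simp
qed

lemma idem_mult_cancel:
  fixes x y z :: "'a::radicable_idem_semifield"
  assumes "z \<noteq> 0" "x * z = y * z" shows "x = y"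
proof -
  have "x * (z * inverse z) = y * (z * inverse z)"
    using assms(2) by (simp flip: mult.assoc)
  then show ?thesis using assms(1) by (simp add: idem_right_inverse)
qed

lemma idem_mult_mono:
  fixes x y z :: "'a::radicable_idem_semifield"
  assumes "x \<le> y" shows "x * z \<le> y * z"
  using assms by (simp add: idem_le_iff flip: distrib_right)

lemma idem_power_mono:
  fixes x y :: "'a::radicable_idem_semifield"
  assumes "x \<le> y" shows "x ^ p \<le> y ^ p"
proof (induction p)
  case (Suc p)
  have "x * x ^ p \<le> y * x ^ p" using assms by (rule idem_mult_mono)
  also have "\<dots> \<le> y * y ^ p" using idem_mult_mono[OF Suc, of y] by (simp add: mult.commute)
  finally show ?case by simp
qed simp

lemma idem_power_nonzero:
  fixes x :: "'a::radicable_idem_semifield"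
  assumes "x \<noteq> 0" shows "x ^ p \<noteq> 0"
proof (induction p)
  case 0
  have "(1::'a) \<noteq> 0" by simp
  then show ?case by simp
next
  case (Suc p)
  then show ?case using assms idem_mult_eq_0 by fastforce
qed

lemma idem_power_inject_aux:
  fixes x y :: "'a::radicable_idem_semifield"
  assumes "x \<le> y" "x ^ Suc p = y ^ Suc p" shows "x = y"
proof (cases "y = 0")
  case True
  have "(0::'a) + x = x" by simp
  then have "0 \<le> x" by (simp only: idem_le_iff)
  then show ?thesis using assms(1) True by simp
next
  case False
  have "y * y ^ p = x * x ^ p" using assms(2) by simp
  also have "\<dots> \<le> x * y ^ p"
    using idem_mult_mono[OF idem_power_mono[OF assms(1), of p], of x] by (simp add: mult.commute)
  finally have "y * y ^ p \<le> x * y ^ p" .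
  with idem_mult_mono[OF assms(1), of "y ^ p"] have "x * y ^ p = y * y ^ p" by simp
  then show ?thesis using idem_mult_cancel idem_power_nonzero[OF False] by blast
qed

lemma idem_power_inject:
  fixes x y :: "'a::radicable_idem_semifield"
  assumes "p \<ge> 1" "x ^ p = y ^ p" shows "x = y"
proof -
  obtain q where "p = Suc q" using assms(1) by (cases p) auto
  then show ?thesis
    using assms(2) idem_power_inject_aux[of x y q] idem_power_inject_aux[of y x q]
    by (metis linear)
qed

lemma rad_power:
  fixes x :: "'a::radicable_idem_semifield"
  assumes "p \<ge> 1" shows "rad p x ^ p = x"
proof (cases "x = 0")
  case True
  then show ?thesis using assms by (simp add: rad_def power_0_left)
next
  case False
  then obtain y where y: "y ^ p = x" using idem_radicable assms by blast
  have "(THE y. y ^ p = x) ^ p = x"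
    by (rule theI[of "\<lambda>y. y ^ p = x", OF y]) (use y assms idem_power_inject in blast)
  then show ?thesis using False by (simp add: rad_def)
qed


section \<open>Matrices and vectors\<close>

text \<open>
  Row and column vectors are both of type \<open>'a ^ 'n\<close>. The power \<open>^\<close> and the product \<open>*\<close> that the
  library provides on this type are entrywise, hence the separate matrix power \<open>mpow\<close>.
\<close>

primrec mpow :: "'a::semiring_1 ^ 'n ^ 'n \<Rightarrow> nat \<Rightarrow> 'a ^ 'n ^ 'n" where
  "mpow A 0 = mat 1"
| "mpow A (Suc p) = mpow A p ** A"

definition mscale :: "'a::semiring_1 \<Rightarrow> 'a ^ 'n ^ 'm \<Rightarrow> 'a ^ 'n ^ 'm" where
  "mscale c A = (\<chi> i j. c * A $ i $ j)"

definition row_col :: "'a::semiring_1 ^ 'n \<Rightarrow> 'a ^ 'n \<Rightarrow> 'a" where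
  "row_col r c = (\<Sum>i\<in>UNIV. r $ i * c $ i)"

definition col_row :: "'a::semiring_1 ^ 'n \<Rightarrow> 'a ^ 'm \<Rightarrow> 'a ^ 'm ^ 'n" where
  "col_row c r = (\<chi> i j. c $ i * r $ j)"

definition column_regular :: "'a::zero ^ 'n ^ 'm \<Rightarrow> bool" where
  "column_regular C \<longleftrightarrow> (\<forall>j. \<exists>i. C $ i $ j \<noteq> 0)"

definition regular :: "'a::zero ^ 'n \<Rightarrow> bool" where
  "regular x \<longleftrightarrow> (\<forall>i. x $ i \<noteq> 0)"

definition conj_transpose :: "'a::radicable_idem_semifield ^ 'n \<Rightarrow> 'a ^ 'n" where
  "conj_transpose x = (\<chi> i. if x $ i > 0 then inverse (x $ i) else 0)"

definition Tr :: "'a::semiring_1 ^ 'n ^ 'n \<Rightarrow> 'a" where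
  "Tr A = (\<Sum>k=1..CARD('n). trace (mpow A k))"

definition star :: "'a::semiring_1 ^ 'n ^ 'n \<Rightarrow> 'a ^ 'n ^ 'n" where
  "star A = (\<Sum>k<CARD('n). mpow A k)"

definition spectral_rad :: "'a::radicable_idem_semifield ^ 'n ^ 'n \<Rightarrow> 'a" where
  "spectral_rad A = (\<Sum>k=1..CARD('n). rad k (trace (mpow A k)))"


section \<open>The optimization problem\<close>

definition objective :: "'a::radicable_idem_semifield ^ 'n ^ 'n \<Rightarrow> 'a ^ 'n \<Rightarrow> 'a" where
  "objective A x = row_col (conj_transpose x) (A *v x)"

definition feasible_set ::
  "'a::radicable_idem_semifield ^ 'n ^ 'n \<Rightarrow> 'a ^ 'n \<Rightarrow> 'a ^ 'n ^ 'm \<Rightarrow> 'a ^ 'm \<Rightarrow> ('a ^ 'n) set" where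
  "feasible_set B g C h = {x. regular x \<and> B *v x + g \<le> x \<and> C *v x \<le> h}"

text \<open>The index tuple \<open>(i\<^sub>0, \<dots>, i\<^sub>k)\<close> is a list of length \<open>k + 1\<close>.\<close>

definition index_tuples :: "nat \<Rightarrow> nat \<Rightarrow> nat list set" where
  "index_tuples k N = {is. length is = Suc k \<and> sum_list is \<le> N}"

lemma finite_index_tuples: "finite (index_tuples k N)"
proof (rule finite_subset)
  show "index_tuples k N \<subseteq> {is. set is \<subseteq> {..N} \<and> length is = Suc k}"
    unfolding index_tuples_def using member_le_sum_list by fastforce
  show "finite {is. set is \<subseteq> {..N} \<and> length is = Suc k}"
    by (intro finite_lists_length_eq) simp
qed

text \<open>
  \<open>alt_prod A B [i\<^sub>1, \<dots>, i\<^sub>k]\<close> is the product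
  \<open>(A ** mpow B i\<^sub>1) ** \<dots> ** (A ** mpow B i\<^sub>k)\<close>.
\<close>

primrec alt_prod :: "'a::semiring_1 ^ 'n ^ 'n \<Rightarrow> 'a ^ 'n ^ 'n \<Rightarrow> nat list \<Rightarrow> 'a ^ 'n ^ 'n" where
  "alt_prod A B [] = mat 1"
| "alt_prod A B (i # is) = A ** mpow B i ** alt_prod A B is"

definition theta ::
  "'a::radicable_idem_semifield ^ 'n ^ 'n \<Rightarrow> 'a ^ 'n ^ 'n \<Rightarrow> 'a ^ 'n \<Rightarrow> 'a ^ 'n ^ 'm \<Rightarrow> 'a ^ 'm \<Rightarrow> 'a" where
  "theta A B g C h =
    (\<Sum>k=1..CARD('n). \<Sum>is\<in>index_tuples k (CARD('n) - k).
      rad k (trace (mpow B (hd is) ** alt_prod A B (tl is)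
        ** (mat 1 + col_row g (conj_transpose h) ** C))))"

end

theory Submission
  imports Defs
begin

text \<open>
  For regular \<open>x\<close>, \<open>objective A x \<le> \<mu>\<close> means \<open>A x \<le> \<mu> x\<close>. A word \<open>W\<close> in \<open>A\<close> and \<open>B\<close> with \<open>k\<close> factors
  \<open>A\<close> then satisfies \<open>W x \<le> \<mu>\<^sup>k x\<close> for feasible \<open>x\<close>, and with \<open>g \<le> x\<close> and \<open>h\<^sup>- C x \<le> 1\<close> both
  \<open>tr W\<close> and \<open>h\<^sup>- C W g\<close> are at most \<open>\<mu>\<^sup>k\<close>; this is the lower bound \<open>\<theta> \<le> \<mu>\<close>.
  Conversely put \<open>D = \<theta>\<^sup>-\<^sup>1 A + B\<close>. Expanding the powers of \<open>D\<close> into words gives \<open>Tr D \<le> 1\<close> and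
  \<open>h\<^sup>- C D\<^sup>* g \<le> 1\<close>. The first makes the solutions of \<open>D x \<le> x\<close> exactly the vectors \<open>D\<^sup>* u\<close>, the second
  makes the interval for \<open>u\<close> nonempty.
\<close>

section \<open>Order and roots\<close>

lemma idem_zero_le: "0 \<le> (x::'a::radicable_idem_semifield)"
  by (simp add: idem_le_iff)

lemma idem_zero_less_iff: "0 < (x::'a::radicable_idem_semifield) \<longleftrightarrow> x \<noteq> 0"
  using idem_zero_le[of x] by auto

text \<open>Idempotency makes addition the binary join of the order, so a bound on a sum is a bound
  on each summand.\<close>

lemma idem_add_le_iff:
  fixes x y c :: "'a::radicable_idem_semifield"
  shows "x + y \<le> c \<longleftrightarrow> x \<le> c \<and> y \<le> c"
proof
  assume "x + y \<le> c"
  moreover have "x \<le> x + y" "y \<le> x + y"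
    by (simp_all add: idem_le_iff add.assoc[symmetric] add.commute[of y x] idem_add)
      (simp add: add.assoc idem_add)
  ultimately show "x \<le> c \<and> y \<le> c" by (meson order_trans)
qed (simp add: idem_le_iff add.assoc)

lemma idem_sum_le_iff:
  fixes f :: "'b \<Rightarrow> 'a::radicable_idem_semifield"
  assumes "finite S"
  shows "sum f S \<le> c \<longleftrightarrow> (\<forall>i\<in>S. f i \<le> c)"
  using assms by induction (simp_all add: idem_zero_le idem_add_le_iff)

lemma idem_le_sum:
  fixes f :: "'b \<Rightarrow> 'a::radicable_idem_semifield"
  assumes "finite S" "i \<in> S"
  shows "f i \<le> sum f S"
  using idem_sum_le_iff[OF assms(1), of f "sum f S"] assms(2) by simp

text \<open>In a linear order the join of finitely many terms is their maximum, hence one of them.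
  This lets an entry of a matrix power be realized by a single walk.\<close>

lemma idem_sum_attained:
  fixes f :: "'b \<Rightarrow> 'a::radicable_idem_semifield"
  assumes "finite S" "S \<noteq> {}"
  shows "\<exists>i\<in>S. sum f S = f i"
proof -
  have "Max (f ` S) \<in> f ` S" using assms by simp
  then obtain i where i: "i \<in> S" "f i = Max (f ` S)" by force
  then have "sum f S \<le> f i" using assms by (simp add: idem_sum_le_iff)
  then show ?thesis using i(1) idem_le_sum[OF assms(1) i(1), of f] by (metis order_antisym)
qed

lemma idem_mult_mono_left: "x \<le> y \<Longrightarrow> z * x \<le> z * (y::'a::radicable_idem_semifield)"
  using idem_mult_mono[of x y z] by (simp add: mult.commute)

lemma idem_left_inverse: "x \<noteq> 0 \<Longrightarrow> inverse x * x = (1::'a::radicable_idem_semifield)"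
  using idem_right_inverse[of x] by (simp add: mult.commute)

lemma idem_inverse_nonzero: "x \<noteq> 0 \<Longrightarrow> inverse (x::'a::radicable_idem_semifield) \<noteq> 0"
  using idem_right_inverse[of x] by force

lemma idem_inverse_mult_le_iff:
  fixes x y c :: "'a::radicable_idem_semifield"
  assumes "x \<noteq> 0"
  shows "inverse x * y \<le> c \<longleftrightarrow> y \<le> x * c"
proof
  assume "inverse x * y \<le> c"
  then have "x * (inverse x * y) \<le> x * c" by (rule idem_mult_mono_left)
  then show "y \<le> x * c" using assms by (simp add: mult.assoc[symmetric] idem_right_inverse)
next
  assume "y \<le> x * c"
  then have "inverse x * y \<le> inverse x * (x * c)" by (rule idem_mult_mono_left)
  then show "inverse x * y \<le> c" using assms by (simp add: mult.assoc[symmetric] idem_left_inverse)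
qed

lemma idem_mult_le_cancel_right:
  fixes x y z :: "'a::radicable_idem_semifield"
  assumes "z \<noteq> 0" "x * z \<le> y * z" shows "x \<le> y"
  using idem_mult_mono[OF assms(2), of "inverse z"] assms(1)
  by (simp add: mult.assoc idem_right_inverse)

text \<open>One factor at a time crosses the inequality, hence the arbitrary \<open>y\<close> in the
  induction. It turns bounds by \<open>\<theta> ^ k\<close> into bounds by 1 for scaled
  words.\<close>

lemma idem_inverse_power_mult_le_one_iff:
  fixes t y :: "'a::radicable_idem_semifield"
  assumes "t \<noteq> 0"
  shows "inverse t ^ k * y \<le> 1 \<longleftrightarrow> y \<le> t ^ k"
proof (induction k arbitrary: y)
  case (Suc k)
  have "inverse t ^ Suc k * y \<le> 1 \<longleftrightarrow> inverse t ^ k * (inverse t * y) \<le> 1"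
    by (simp add: ac_simps)
  also have "\<dots> \<longleftrightarrow> y \<le> t ^ Suc k"
    using Suc idem_inverse_mult_le_iff[OF assms] by simp
  finally show ?case .
qed simp

text \<open>Root and power form a Galois connection, which removes the roots from bounds on
  \<open>theta\<close> and \<open>spectral_rad\<close>. If \<open>x \<le> y ^ p\<close> but
  \<open>y < rad p x\<close>, monotonicity makes both \<open>p\<close>-th powers equal, against
  uniqueness of roots.\<close>

lemma rad_le_iff:
  fixes x y :: "'a::radicable_idem_semifield"
  assumes "p \<ge> 1"
  shows "rad p x \<le> y \<longleftrightarrow> x \<le> y ^ p"
proof
  assume "rad p x \<le> y"
  then show "x \<le> y ^ p" using idem_power_mono[of "rad p x" y p] rad_power[OF assms, of x] by simp
next
  assume le: "x \<le> y ^ p"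
  show "rad p x \<le> y"
  proof (rule ccontr)
    assume "\<not> rad p x \<le> y"
    then have less: "y < rad p x" by simp
    then have "y ^ p \<le> x"
      using idem_power_mono[of y "rad p x" p] rad_power[OF assms, of x] by simp
    with le have "y ^ p = rad p x ^ p" using rad_power[OF assms, of x] by simp
    with less show False using idem_power_inject[OF assms] by blast
  qed
qed


section \<open>Matrices and vectors over the semifield\<close>

lemma matrix_vector_nth: "(A *v x) $ i = (\<Sum>j\<in>UNIV. A $ i $ j * x $ j)"
  by (simp add: matrix_vector_mult_def)

lemma matrix_matrix_nth: "(A ** B) $ i $ j = (\<Sum>k\<in>UNIV. A $ i $ k * B $ k $ j)"
  by (simp add: matrix_matrix_mult_def)

lemma vector_matrix_nth: "(x v* A) $ j = (\<Sum>i\<in>UNIV. x $ i * A $ i $ j)"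
  by (simp add: vector_matrix_mult_def)

lemma idem_matrix_vector_mono:
  fixes A :: "'a::radicable_idem_semifield ^ 'n ^ 'm"
  assumes "x \<le> y" shows "A *v x \<le> A *v y"
  unfolding less_eq_vec_def matrix_vector_nth
  using assms by (auto simp: less_eq_vec_def idem_sum_le_iff
      intro!: order_trans[OF _ idem_le_sum[where f = "\<lambda>j. A $ i $ j * y $ j" for i]]
        idem_mult_mono_left)

lemma idem_vec_add_le_iff:
  fixes x y z :: "'a::radicable_idem_semifield ^ 'n"
  shows "x + y \<le> z \<longleftrightarrow> x \<le> z \<and> y \<le> z"
  by (auto simp: less_eq_vec_def idem_add_le_iff)

lemma matrix_vector_mult_vsmult:
  fixes A :: "'a::comm_semiring_1 ^ 'n ^ 'm"
  shows "A *v (c *s x) = c *s (A *v x)"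
  by (simp add: vec_eq_iff matrix_vector_nth sum_distrib_left ac_simps)

lemma mscale_mult_vector:
  fixes A :: "'a::comm_semiring_1 ^ 'n ^ 'm"
  shows "mscale c A *v x = c *s (A *v x)"
  by (simp add: vec_eq_iff matrix_vector_nth mscale_def sum_distrib_left ac_simps)

lemma mscale_mult_mscale:
  fixes A :: "'a::comm_semiring_1 ^ 'n ^ 'm" and B :: "'a ^ 'p ^ 'n"
  shows "mscale c A ** mscale d B = mscale (c * d) (A ** B)"
  by (simp add: vec_eq_iff matrix_matrix_nth mscale_def sum_distrib_left ac_simps)

lemma mscale_one: "mscale 1 A = A"
  by (simp add: mscale_def vec_eq_iff)

lemma matrix_mult_mscale:
  fixes A :: "'a::comm_semiring_1 ^ 'n ^ 'm" and B :: "'a ^ 'p ^ 'n"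
  shows "A ** mscale d B = mscale d (A ** B)"
  using mscale_mult_mscale[of 1 A d B] by (simp add: mscale_one)

lemma matrix_add_mult_right: "(A + B) ** C = A ** C + B ** (C::'a::semiring_1 ^ 'p ^ 'n)"
  by (simp add: vec_eq_iff matrix_matrix_nth distrib_right sum.distrib)

lemma trace_mscale: "trace (mscale c A) = c * trace A"
  by (simp add: trace_def mscale_def sum_distrib_left)

lemma mpow_Suc_left: "mpow A (Suc p) = A ** mpow A p"
  by (induction p) (simp_all flip: matrix_mul_assoc)

lemma row_col_vector_matrix:
  fixes r :: "'a::comm_semiring_1 ^ 'm"
  shows "row_col (r v* A) c = row_col r (A *v c)"
  unfolding row_col_def vector_matrix_nth matrix_vector_nth sum_distrib_left sum_distrib_right
  by (subst sum.swap) (simp add: mult.assoc)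

lemma row_col_add_right: "row_col r (x + y) = row_col r x + row_col r y"
  by (simp add: row_col_def distrib_left sum.distrib)

lemma row_col_vsmult_right:
  fixes r :: "'a::comm_semiring_1 ^ 'n"
  shows "row_col r (c *s x) = c * row_col r x"
  by (simp add: row_col_def sum_distrib_left ac_simps)

lemma row_col_mono:
  fixes r :: "'a::radicable_idem_semifield ^ 'n"
  assumes "x \<le> y" shows "row_col r x \<le> row_col r y"
  unfolding row_col_def using assms
  by (auto simp: less_eq_vec_def idem_sum_le_iff
      intro!: order_trans[OF _ idem_le_sum[where f = "\<lambda>j. r $ j * y $ j"]] idem_mult_mono_left)

text \<open>The inserted matrix is the outer product of \<open>g\<close> and
  \<open>s = r v* C\<close>, and the trace of \<open>W\<close> times such a product is the scalar
  \<open>s W g\<close>.\<close>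

lemma trace_mult_col_row:
  fixes W :: "'a::comm_semiring_1 ^ 'n ^ 'n" and r :: "'a ^ 'm" and C :: "'a ^ 'n ^ 'm"
  shows "trace (W ** (col_row g r ** C)) = row_col ((r v* C) v* W) g"
proof -
  have "col_row g r ** C = col_row g (r v* C)"
    by (simp add: vec_eq_iff matrix_matrix_nth vector_matrix_nth col_row_def sum_distrib_left
        ac_simps)
  moreover have "trace (W ** col_row g s) = row_col s (W *v g)" for s
    by (simp add: trace_def row_col_def matrix_matrix_nth matrix_vector_nth col_row_def
        sum_distrib_left ac_simps)
  ultimately show ?thesis by (simp add: row_col_vector_matrix)
qed

section \<open>Conjugate transposition and regular vectors\<close>

lemma conj_transpose_nth_regular:
  "regular y \<Longrightarrow> conj_transpose y $ i = inverse (y $ i)"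
  by (simp add: conj_transpose_def regular_def idem_zero_less_iff)

text \<open>Entrywise residuation. With general \<open>c\<close> it makes a bound on the objective
  linear in \<open>x\<close>; with \<open>c = 1\<close> it rewrites
  \<open>C *v x \<le> h\<close>.\<close>

lemma row_col_conj_transpose_le_iff:
  fixes y z :: "'a::radicable_idem_semifield ^ 'n"
  assumes "regular y"
  shows "row_col (conj_transpose y) z \<le> c \<longleftrightarrow> z \<le> c *s y"
  using assms
  by (auto simp: row_col_def idem_sum_le_iff less_eq_vec_def conj_transpose_nth_regular
      regular_def mult.commute[of c] idem_inverse_mult_le_iff)

text \<open>Regularity matters: at a zero entry of \<open>r\<close> the left side would force
  \<open>u $ i = 0\<close>, while the right side would leave it free.\<close>

lemma le_conj_transpose_iff:
  fixes r u :: "'a::radicable_idem_semifield ^ 'n"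
  assumes "regular r"
  shows "u \<le> conj_transpose r \<longleftrightarrow> row_col r u \<le> 1"
proof -
  have "u $ i \<le> inverse (r $ i) \<longleftrightarrow> r $ i * u $ i \<le> 1" for i
  proof -
    have nz: "r $ i \<noteq> 0" using assms by (simp add: regular_def)
    show ?thesis
      using idem_mult_mono_left[of "u $ i" "inverse (r $ i)" "r $ i"]
        idem_mult_mono_left[of "r $ i * u $ i" 1 "inverse (r $ i)"] nz
      by (auto simp: idem_right_inverse idem_left_inverse mult.assoc[symmetric])
  qed
  then show ?thesis
    using assms by (simp add: less_eq_vec_def row_col_def idem_sum_le_iff
        conj_transpose_nth_regular)
qed

lemma regular_mono:
  fixes x y :: "'a::radicable_idem_semifield ^ 'n"
  assumes "regular x" "x \<le> y" shows "regular y"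
  using assms idem_zero_le unfolding regular_def less_eq_vec_def by (metis order_antisym)

lemma regular_conj_transpose: "regular y \<Longrightarrow> regular (conj_transpose y)"
  by (simp add: regular_def conj_transpose_nth_regular[unfolded regular_def] idem_inverse_nonzero)

text \<open>There are no zero divisors and a sum dominates its terms, so one nonzero entry in each
  column of \<open>C\<close> suffices.\<close>

lemma regular_vector_matrix:
  fixes r :: "'a::radicable_idem_semifield ^ 'm"
  assumes "regular r" "column_regular C"
  shows "regular (r v* C)"
  unfolding regular_def
proof
  fix j
  obtain i where "C $ i $ j \<noteq> 0" using assms(2) by (auto simp: column_regular_def)
  then have "r $ i * C $ i $ j \<noteq> 0" using assms(1) idem_mult_eq_0 by (auto simp: regular_def)
  then show "(r v* C) $ j \<noteq> 0"
    unfolding vector_matrix_nth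
    using idem_le_sum[of UNIV i "\<lambda>i. r $ i * C $ i $ j"] idem_zero_le
    by (metis finite_class.finite_UNIV UNIV_I order_antisym)
qed

lemma objective_le_iff:
  "regular x \<Longrightarrow> objective A x \<le> c \<longleftrightarrow> A *v x \<le> c *s x"
  by (simp add: objective_def row_col_conj_transpose_le_iff)


section \<open>Kleene star\<close>

lemma star_nth: "star (D::'a::semiring_1 ^ 'n ^ 'n) $ i $ j = (\<Sum>p<CARD('n). mpow D p $ i $ j)"
  by (simp add: star_def sum_component)

lemma mpow_le_star:
  fixes D :: "'a::radicable_idem_semifield ^ 'n ^ 'n"
  assumes "p < CARD('n)"
  shows "mpow D p $ i $ j \<le> star D $ i $ j"
  unfolding star_nth using assms by (intro idem_le_sum) auto

lemma star_mult_vector_nth: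
  fixes D :: "'a::comm_semiring_1 ^ 'n ^ 'n"
  shows "(star D *v x) $ i = (\<Sum>p<CARD('n). (mpow D p *v x) $ i)"
  by (simp add: matrix_vector_nth star_nth sum_distrib_right) (rule sum.swap)

lemma le_star_mult_vector:
  fixes D :: "'a::radicable_idem_semifield ^ 'n ^ 'n"
  shows "x \<le> star D *v x"
  unfolding less_eq_vec_def star_mult_vector_nth
proof
  fix i
  show "x $ i \<le> (\<Sum>p<CARD('n). (mpow D p *v x) $ i)"
    using idem_le_sum[of "{..<CARD('n)}" 0 "\<lambda>p. (mpow D p *v x) $ i"] by simp
qed

lemma mpow_mult_vector_le:
  fixes D :: "'a::radicable_idem_semifield ^ 'n ^ 'n"
  assumes "D *v x \<le> x" shows "mpow D p *v x \<le> x"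
proof (induction p)
  case (Suc p)
  have "mpow D (Suc p) *v x = mpow D p *v (D *v x)" by (simp add: matrix_vector_mul_assoc)
  also have "\<dots> \<le> mpow D p *v x" using assms by (rule idem_matrix_vector_mono)
  also have "\<dots> \<le> x" by (rule Suc)
  finally show ?case .
qed simp

text \<open>A solution dominates every \<open>mpow D p *v x\<close>, and the power 0 gives the
  reverse inequality. Each solution is thus generated by itself as parameter.\<close>

lemma star_mult_vector_eq:
  fixes D :: "'a::radicable_idem_semifield ^ 'n ^ 'n"
  assumes "D *v x \<le> x" shows "star D *v x = x"
proof (rule order_antisym)
  show "star D *v x \<le> x"
    unfolding less_eq_vec_def star_mult_vector_nth
    using mpow_mult_vector_le[OF assms] by (simp add: idem_sum_le_iff less_eq_vec_def)
qed (rule le_star_mult_vector)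

text \<open>A walk of \<open>p\<close> steps is the list of its \<open>p + 1\<close> nodes; lists
  with at most one node carry the empty product.\<close>

fun walk_weight :: "'a::semiring_1 ^ 'n ^ 'n \<Rightarrow> 'n list \<Rightarrow> 'a" where
  "walk_weight D (x # y # xs) = D $ x $ y * walk_weight D (y # xs)"
| "walk_weight D _ = 1"

text \<open>The two factors share the node \<open>y\<close>, so every edge is counted in exactly one
  of them.\<close>

lemma walk_weight_append:
  "walk_weight D (xs @ y # ys) = walk_weight D (xs @ [y]) * walk_weight D (y # ys)"
  by (induction D xs rule: walk_weight.induct) (simp_all add: mult.assoc)

text \<open>The induction picks a best second node at each step. The entry must be nonzero: an
  off-diagonal zero of the identity has no walk of zero steps.\<close>

lemma mpow_attained_by_walk:
  fixes D :: "'a::radicable_idem_semifield ^ 'n ^ 'n"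
  assumes "mpow D p $ i $ j \<noteq> 0"
  shows "\<exists>xs. length xs = Suc p \<and> hd xs = i \<and> last xs = j \<and> walk_weight D xs = mpow D p $ i $ j"
  using assms
proof (induction p arbitrary: i)
  case 0
  then have "i = j" by (auto simp: mat_def split: if_splits)
  then show ?case by (intro exI[of _ "[i]"]) (simp add: mat_def)
next
  case (Suc p)
  obtain l where l: "mpow D (Suc p) $ i $ j = D $ i $ l * mpow D p $ l $ j"
    unfolding mpow_Suc_left matrix_matrix_nth
    using idem_sum_attained[of UNIV "\<lambda>k. D $ i $ k * mpow D p $ k $ j"] by auto
  with Suc.prems have "mpow D p $ l $ j \<noteq> 0" by auto
  with Suc.IH obtain xs where xs: "length xs = Suc p" "hd xs = l" "last xs = j"
    "walk_weight D xs = mpow D p $ l $ j" by blast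
  then obtain ys where "xs = l # ys" by (cases xs) auto
  with xs l show ?case by (intro exI[of _ "i # xs"]) simp
qed

lemma walk_weight_le_mpow:
  fixes D :: "'a::radicable_idem_semifield ^ 'n ^ 'n"
  assumes "xs \<noteq> []"
  shows "walk_weight D xs \<le> mpow D (length xs - 1) $ hd xs $ last xs"
  using assms
proof (induction xs)
  case (Cons x xs)
  show ?case
  proof (cases xs)
    case Nil
    then show ?thesis by (simp add: mat_def)
  next
    case (Cons y ys)
    have "walk_weight D (x # xs) = D $ x $ y * walk_weight D xs" using Cons by simp
    also have "\<dots> \<le> D $ x $ y * mpow D (length ys) $ y $ last xs"
      using Cons.IH Cons by (intro idem_mult_mono_left) simp
    also have "\<dots> \<le> mpow D (Suc (length ys)) $ x $ last xs"
      unfolding mpow_Suc_left matrix_matrix_nth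
      by (rule idem_le_sum[where f = "\<lambda>k. D $ x $ k * mpow D (length ys) $ k $ last xs"]) auto
    finally show ?thesis using Cons by simp
  qed
qed simp

text \<open>A walk with \<open>CARD('n)\<close> steps repeats a node; the closed part in between weighs at most
  \<open>Tr D \<le> 1\<close> and can be cut out.\<close>

lemma mpow_card_le_star:
  fixes D :: "'a::radicable_idem_semifield ^ 'n ^ 'n"
  assumes "Tr D \<le> 1"
  shows "mpow D CARD('n) $ i $ j \<le> star D $ i $ j"
proof (cases "mpow D CARD('n) $ i $ j = 0")
  case True
  then show ?thesis by (simp add: idem_zero_le)
next
  case False
  then obtain xs where xs: "length xs = Suc CARD('n)" "hd xs = i" "last xs = j"
    "walk_weight D xs = mpow D CARD('n) $ i $ j" using mpow_attained_by_walk by blast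
  have "\<not> distinct xs"
    using card_mono[of "UNIV :: 'n set" "set xs"] distinct_card[of xs] xs(1) by auto
  then obtain as y bs cs where dec: "xs = as @ [y] @ bs @ [y] @ cs"
    using not_distinct_decomp by blast
  \<comment> \<open>The closed part has \<open>length bs + 1\<close> steps, between 1 and
    \<open>CARD('n)\<close>, so \<open>Tr D\<close> bounds it. The rest has at most
    \<open>CARD('n) - 1\<close> steps, within the range of \<open>star D\<close>.\<close>
  have len: "length as + length bs + length cs + 1 = CARD('n)" using dec xs(1) by simp
  have "walk_weight D (y # bs @ [y]) \<le> mpow D (Suc (length bs)) $ y $ y"
    using walk_weight_le_mpow[of "y # bs @ [y]" D] by simp
  also have "\<dots> \<le> trace (mpow D (Suc (length bs)))"
    unfolding trace_def
    by (rule idem_le_sum[where f = "\<lambda>i. mpow D (Suc (length bs)) $ i $ i"]) auto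
  also have "\<dots> \<le> Tr D"
    unfolding Tr_def
    by (rule idem_le_sum[where f = "\<lambda>k. trace (mpow D k)"]) (use len in auto)
  finally have cycle: "walk_weight D (y # bs @ [y]) \<le> 1" using assms by simp
  have "walk_weight D xs
      = walk_weight D (as @ [y]) * (walk_weight D (y # bs @ [y]) * walk_weight D (y # cs))"
    unfolding dec using walk_weight_append[of D as y "bs @ [y] @ cs"]
      walk_weight_append[of D "y # bs" y cs] by simp
  also have "\<dots> \<le> walk_weight D (as @ [y]) * (1 * walk_weight D (y # cs))"
    using cycle by (intro idem_mult_mono_left idem_mult_mono)
  also have "\<dots> = walk_weight D (as @ y # cs)" using walk_weight_append[of D as y cs] by simp
  also have "\<dots> \<le> mpow D (length as + length cs) $ hd (as @ y # cs) $ last (as @ y # cs)"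
    using walk_weight_le_mpow[of "as @ y # cs" D] by simp
  also have "hd (as @ y # cs) = i" using xs(2) dec by (cases as) auto
  also have "last (as @ y # cs) = j" using xs(3) dec by auto
  also have "mpow D (length as + length cs) $ i $ j \<le> star D $ i $ j"
    using len by (intro mpow_le_star) simp
  finally show ?thesis using xs(4) by simp
qed

text \<open>Multiplying by \<open>D\<close> raises each power in the star by one. Only the power
  \<open>CARD('n)\<close> leaves the range, and \<open>mpow_card_le_star\<close> brings it
  back.\<close>

lemma mult_star_mult_vector_le:
  fixes D :: "'a::radicable_idem_semifield ^ 'n ^ 'n"
  assumes "Tr D \<le> 1"
  shows "D *v (star D *v u) \<le> star D *v u"
proof -
  have "(mpow D (Suc p) *v u) $ i \<le> (star D *v u) $ i" if "p < CARD('n)" for p i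
  proof -
    have "mpow D (Suc p) $ i $ j \<le> star D $ i $ j" for j
    proof (cases "Suc p < CARD('n)")
      case True
      then show ?thesis by (rule mpow_le_star)
    next
      case False
      with that have "Suc p = CARD('n)" by simp
      then show ?thesis using mpow_card_le_star[OF assms] by metis
    qed
    then show ?thesis
      unfolding matrix_vector_nth
      by (auto simp: idem_sum_le_iff simp del: mpow.simps
          intro!: order_trans[OF _ idem_le_sum[where f = "\<lambda>j. star D $ i $ j * u $ j"]]
            idem_mult_mono)
  qed
  moreover have "(D *v (star D *v u)) $ i = (\<Sum>p<CARD('n). (mpow D (Suc p) *v u) $ i)" for i
  proof -
    have "(D *v (star D *v u)) $ i
        = (\<Sum>l\<in>UNIV. \<Sum>p<CARD('n). D $ i $ l * (mpow D p *v u) $ l)"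
      by (simp add: matrix_vector_nth[of D] star_mult_vector_nth sum_distrib_left)
    also have "\<dots> = (\<Sum>p<CARD('n). (D *v (mpow D p *v u)) $ i)"
      by (subst sum.swap) (simp add: matrix_vector_nth[of D])
    finally show ?thesis by (simp only: mpow_Suc_left matrix_vector_mul_assoc)
  qed
  ultimately show ?thesis by (simp add: less_eq_vec_def idem_sum_le_iff del: mpow.simps)
qed


section \<open>Words in two matrices\<close>

text \<open>Expanding the power of a sum gives all words, each being a \<open>B\<close>-power times an \<open>alt_prod\<close>;
  additivity of \<open>\<phi>\<close> is all that is needed to bound the expansion word by word.\<close>

lemma additive_mpow_sum_le:
  fixes A B :: "'a::radicable_idem_semifield ^ 'n ^ 'n" and \<phi> :: "'a ^ 'n ^ 'n \<Rightarrow> 'a"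
  assumes "\<And>X Y. \<phi> (X + Y) = \<phi> X + \<phi> Y"
    and "\<And>k i is. length is = k \<Longrightarrow> k + i + sum_list is = m \<Longrightarrow>
      \<phi> (mscale (t ^ k) (mpow B i ** alt_prod A B is)) \<le> c"
  shows "\<phi> (mpow (mscale t A + B) m) \<le> c"
  using assms
proof (induction m arbitrary: \<phi>)
  case 0
  show ?case using "0.prems"(2)[of "[]" 0 0] by (simp add: mscale_one)
next
  case (Suc m)
  let ?D = "mscale t A + B"
  \<comment> \<open>The leftmost factor is absorbed into the functional, which is why
    \<open>\<phi>\<close> is arbitrary. A leading \<open>A\<close> pushes the exponent
    \<open>i\<close> onto the list and leaves exponent 0 in front; a leading \<open>B\<close> raises
    \<open>i\<close> by one.\<close>
  have "\<phi> (mscale t A ** mpow ?D m) \<le> c"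
  proof (rule Suc.IH[where \<phi> = "\<lambda>X. \<phi> (mscale t A ** X)"])
    fix k i :: nat and "is" :: "nat list"
    assume "length is = k" "k + i + sum_list is = m"
    then show "\<phi> (mscale t A ** mscale (t ^ k) (mpow B i ** alt_prod A B is)) \<le> c"
      using Suc.prems(2)[of "i # is" "Suc k" 0]
      by (simp add: mscale_mult_mscale matrix_mul_assoc)
  qed (simp add: matrix_add_ldistrib Suc.prems(1))
  moreover have "\<phi> (B ** mpow ?D m) \<le> c"
  proof (rule Suc.IH[where \<phi> = "\<lambda>X. \<phi> (B ** X)"])
    fix k i :: nat and "is" :: "nat list"
    assume "length is = k" "k + i + sum_list is = m"
    then show "\<phi> (B ** mscale (t ^ k) (mpow B i ** alt_prod A B is)) \<le> c"
      using Suc.prems(2)[of "is" k "Suc i"]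
      by (simp add: matrix_mult_mscale matrix_mul_assoc mpow_Suc_left del: mpow.simps)
  qed (simp add: matrix_add_ldistrib Suc.prems(1))
  ultimately show ?case
    by (simp add: mpow_Suc_left matrix_add_mult_right Suc.prems(1) idem_add_le_iff del: mpow.simps)
qed

text \<open>Each factor \<open>A\<close> costs one \<open>c\<close> and the powers of
  \<open>B\<close> cost nothing.\<close>

lemma alt_prod_mult_vector_le:
  fixes A B :: "'a::radicable_idem_semifield ^ 'n ^ 'n"
  assumes "A *v x \<le> c *s x" "B *v x \<le> x"
  shows "alt_prod A B is *v x \<le> c ^ length is *s x"
proof (induction "is")
  case (Cons i "is")
  have "alt_prod A B (i # is) *v x = A *v (mpow B i *v (alt_prod A B is *v x))"
    by (simp add: matrix_vector_mul_assoc matrix_mul_assoc)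
  also have "\<dots> \<le> A *v (mpow B i *v (c ^ length is *s x))"
    using Cons by (intro idem_matrix_vector_mono)
  also have "\<dots> = c ^ length is *s (A *v (mpow B i *v x))"
    by (simp add: matrix_vector_mult_vsmult)
  also have "\<dots> \<le> c ^ length is *s (c *s x)"
  proof -
    have "A *v (mpow B i *v x) \<le> c *s x"
      using idem_matrix_vector_mono[OF mpow_mult_vector_le[OF assms(2)]] assms(1)
      by (rule order_trans)
    then show ?thesis
      by (auto simp: less_eq_vec_def mult.assoc intro: idem_mult_mono_left)
  qed
  also have "\<dots> = c ^ length (i # is) *s x" by (simp add: vec_eq_iff ac_simps)
  finally show ?case .
qed simp

lemma alt_prod_replicate_0: "alt_prod A B (replicate k 0) = mpow A k"
  by (induction k) (simp_all add: mpow_Suc_left del: mpow.simps(2))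

lemma trace_word_mult:
  fixes W :: "'a::comm_semiring_1 ^ 'n ^ 'n" and r :: "'a ^ 'm" and C :: "'a ^ 'n ^ 'm"
  shows "trace (W ** (mat 1 + col_row g r ** C)) = trace W + row_col ((r v* C) v* W) g"
  by (simp add: matrix_add_ldistrib trace_add trace_mult_col_row)

text \<open>Root-free form of the bound: \<open>i\<close> is the leading exponent, \<open>is\<close>
  lists the others, and its length counts the factors \<open>A\<close>. Each trace splits into a
  bound on the word's own trace and one linking \<open>g\<close> to \<open>h\<close>.\<close>

lemma theta_le_iff:
  fixes A B :: "'a::radicable_idem_semifield ^ 'n ^ 'n" and C :: "'a ^ 'n ^ 'm"
  shows "theta A B g C h \<le> c \<longleftrightarrow> (\<forall>i is. is \<noteq> [] \<longrightarrow>
    length is + i + sum_list is \<le> CARD('n) \<longrightarrow>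
      trace (mpow B i ** alt_prod A B is) \<le> c ^ length is
      \<and> row_col ((conj_transpose h v* C) v* (mpow B i ** alt_prod A B is)) g \<le> c ^ length is)"
    (is "_ \<longleftrightarrow> (\<forall>i is. ?P i is)")
proof -
  let ?T = "\<lambda>is k. trace (mpow B (hd is) ** alt_prod A B (tl is)) \<le> c ^ k
      \<and> row_col ((conj_transpose h v* C) v* (mpow B (hd is) ** alt_prod A B (tl is))) g \<le> c ^ k"
  have "theta A B g C h \<le> c \<longleftrightarrow>
      (\<forall>k\<in>{1..CARD('n)}. \<forall>is\<in>index_tuples k (CARD('n) - k). ?T is k)"
    unfolding theta_def
    by (simp add: idem_sum_le_iff finite_index_tuples rad_le_iff trace_word_mult idem_add_le_iff)
  also have "\<dots> \<longleftrightarrow> (\<forall>i is. ?P i is)"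
  proof (intro iffI allI ballI)
    fix i and "is" :: "nat list"
    assume H: "\<forall>k\<in>{1..CARD('n)}. \<forall>is\<in>index_tuples k (CARD('n) - k). ?T is k"
    show "?P i is"
    proof (intro impI)
      assume "is \<noteq> []" "length is + i + sum_list is \<le> CARD('n)"
      \<comment> \<open>The length is at most \<open>CARD('n)\<close>, so the subtraction on natural
        numbers is not truncated.\<close>
      then have "length is \<in> {1..CARD('n)}"
        "i # is \<in> index_tuples (length is) (CARD('n) - length is)"
        by (auto simp: index_tuples_def Suc_le_eq)
      with H have "?T (i # is) (length is)" by blast
      then show "trace (mpow B i ** alt_prod A B is) \<le> c ^ length is
        \<and> row_col ((conj_transpose h v* C) v* (mpow B i ** alt_prod A B is)) g \<le> c ^ length is"
        by simp
    qed
  next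
    fix k "is"
    assume H: "\<forall>i is. ?P i is" and k: "k \<in> {1..CARD('n)}"
      and mem: "is \<in> index_tuples k (CARD('n) - k)"
    then obtain j js where js: "is = j # js" by (cases "is") (auto simp: index_tuples_def)
    with k mem have "length js = k" "js \<noteq> []" "length js + j + sum_list js \<le> CARD('n)"
      by (auto simp: index_tuples_def)
    then show "?T is k" using H[rule_format, of js j] js by simp
  qed
  finally show ?thesis .
qed

lemma word_le_theta:
  fixes A B :: "'a::radicable_idem_semifield ^ 'n ^ 'n" and C :: "'a ^ 'n ^ 'm"
  assumes "is \<noteq> []" "length is + i + sum_list is \<le> CARD('n)"
  shows "trace (mpow B i ** alt_prod A B is) \<le> theta A B g C h ^ length is"
    and "row_col ((conj_transpose h v* C) v* (mpow B i ** alt_prod A B is)) g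
      \<le> theta A B g C h ^ length is"
  using theta_le_iff[of A B g C h "theta A B g C h"] assms by blast+

text \<open>The powers of \<open>A\<close> are the words with all exponents 0. A positive spectral
  radius therefore makes \<open>theta\<close> nonzero, hence invertible.\<close>

lemma spectral_rad_le_theta:
  fixes A B :: "'a::radicable_idem_semifield ^ 'n ^ 'n"
  shows "spectral_rad A \<le> theta A B g C h"
proof -
  have "trace (mpow A k) \<le> theta A B g C h ^ k" if "1 \<le> k" "k \<le> CARD('n)" for k
    using word_le_theta(1)[of "replicate k 0" 0 B A g C h] that
    by (simp add: alt_prod_replicate_0 sum_list_replicate)
  then show ?thesis by (auto simp: spectral_rad_def idem_sum_le_iff rad_le_iff)
qed


section \<open>The lower bound and its attainment\<close>

lemma theta_le_objective:
  fixes A B :: "'a::radicable_idem_semifield ^ 'n ^ 'n" and C :: "'a ^ 'n ^ 'm"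
  assumes "regular h" "x \<in> feasible_set B g C h"
  shows "theta A B g C h \<le> objective A x"
  unfolding theta_le_iff
proof (intro allI impI conjI)
  fix i :: nat and "is" :: "nat list"
  let ?k = "length is" and ?\<mu> = "objective A x" and ?r = "conj_transpose h v* C"
    and ?W = "mpow B i ** alt_prod A B is"
  have x: "regular x" "B *v x \<le> x" "g \<le> x" "C *v x \<le> h"
    using assms(2) by (auto simp: feasible_set_def idem_vec_add_le_iff)
  have "A *v x \<le> ?\<mu> *s x" using objective_le_iff[OF x(1)] by blast
  then have "?W *v x \<le> mpow B i *v (?\<mu> ^ ?k *s x)"
    using alt_prod_mult_vector_le[OF _ x(2), of A ?\<mu> "is"]
    by (simp add: matrix_vector_mul_assoc[symmetric] idem_matrix_vector_mono)
  also have "\<dots> \<le> ?\<mu> ^ ?k *s x"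
    using mpow_mult_vector_le[OF x(2)]
    by (auto simp: matrix_vector_mult_vsmult less_eq_vec_def intro: idem_mult_mono_left)
  finally have W: "?W *v x \<le> ?\<mu> ^ ?k *s x" .
  \<comment> \<open>The diagonal entry times \<open>x $ j\<close> is one term of
    \<open>?W *v x\<close>, and the nonzero \<open>x $ j\<close> cancels.\<close>
  have "?W $ j $ j \<le> ?\<mu> ^ ?k" for j
  proof (rule idem_mult_le_cancel_right)
    show "x $ j \<noteq> 0" using x(1) by (simp add: regular_def)
    have "?W $ j $ j * x $ j \<le> (?W *v x) $ j"
      unfolding matrix_vector_nth by (rule idem_le_sum[where f = "\<lambda>l. ?W $ j $ l * x $ l"]) auto
    then show "?W $ j $ j * x $ j \<le> ?\<mu> ^ ?k * x $ j"
      using W by (auto simp: less_eq_vec_def intro: order_trans)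
  qed
  then show "trace ?W \<le> ?\<mu> ^ ?k" by (simp add: trace_def idem_sum_le_iff)
  \<comment> \<open>Here \<open>g \<le> x\<close> lets the word act on \<open>x\<close>, and
    \<open>C *v x \<le> h\<close> bounds the remaining factor by 1.\<close>
  have "row_col (?r v* ?W) g \<le> row_col ?r (?W *v x)"
    unfolding row_col_vector_matrix by (intro row_col_mono idem_matrix_vector_mono x)
  also have "\<dots> \<le> ?\<mu> ^ ?k * row_col ?r x"
    using row_col_mono[OF W, of ?r] by (simp add: row_col_vsmult_right)
  also have "\<dots> \<le> ?\<mu> ^ ?k * 1"
    using x(4) row_col_conj_transpose_le_iff[OF assms(1), of "C *v x" 1]
    by (intro idem_mult_mono_left) (simp add: row_col_vector_matrix)
  finally show "row_col (?r v* ?W) g \<le> ?\<mu> ^ ?k" by simp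
qed

text \<open>The words in \<open>mpow D m\<close> have \<open>m \<le> CARD('n)\<close> factors. One
  containing \<open>A\<close> occurs in \<open>theta\<close>, and its bound cancels the scaling; one
  without \<open>A\<close> is a power of \<open>B\<close>, covered by the assumption on
  \<open>B\<close>.\<close>

lemma Tr_and_row_col_star_scaled_le_one:
  fixes A B :: "'a::radicable_idem_semifield ^ 'n ^ 'n" and C :: "'a ^ 'n ^ 'm"
  assumes "spectral_rad A > 0"
    and B: "Tr B + row_col (conj_transpose h v* C v* star B) g \<le> 1"
    and D: "D = mscale (inverse (theta A B g C h)) A + B"
  shows "Tr D \<le> 1" and "row_col (conj_transpose h v* C v* star D) g \<le> 1"
proof -
  let ?\<theta> = "theta A B g C h" and ?r = "conj_transpose h v* C"
  have nz: "?\<theta> \<noteq> 0"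
    using assms(1) spectral_rad_le_theta[of A B g C h] by (auto simp: idem_zero_le leD)
  \<comment> \<open>Stated for general \<open>E\<close>: read forwards for \<open>B\<close> and
    backwards for \<open>D\<close>.\<close>
  have star_le: "row_col (?r v* star E) g \<le> 1 \<longleftrightarrow>
      (\<forall>p<CARD('n). row_col ?r (mpow E p *v g) \<le> 1)" for E :: "'a ^ 'n ^ 'n"
  proof -
    have "row_col (?r v* star E) g = (\<Sum>p<CARD('n). row_col ?r (mpow E p *v g))"
      by (simp only: row_col_vector_matrix[of ?r "star E"])
        (simp add: row_col_def star_mult_vector_nth sum_distrib_left sum.swap[of _ UNIV])
    then show ?thesis by (simp add: idem_sum_le_iff lessThan_iff Ball_def)
  qed
  have trB: "trace (mpow B m) \<le> 1" if "1 \<le> m" "m \<le> CARD('n)" for m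
    using B that by (simp add: idem_add_le_iff Tr_def idem_sum_le_iff)
  have gB: "row_col ?r (mpow B m *v g) \<le> 1" if "m < CARD('n)" for m
    using B that star_le[of B] by (simp add: idem_add_le_iff)
  have "trace (mpow D m) \<le> 1" if m: "1 \<le> m" "m \<le> CARD('n)" for m
    unfolding D
  proof (rule additive_mpow_sum_le)
    fix k i :: nat and "is" :: "nat list"
    assume is_len: "length is = k" "k + i + sum_list is = m"
    show "trace (mscale (inverse ?\<theta> ^ k) (mpow B i ** alt_prod A B is)) \<le> 1"
    proof (cases k)
      case 0
      then show ?thesis using is_len m trB by (simp add: mscale_one)
    next
      case (Suc l)
      then have "is \<noteq> []" using is_len by auto
      then have "trace (mpow B i ** alt_prod A B is) \<le> ?\<theta> ^ k"
        using is_len m word_le_theta(1)[of "is" i B A g C h] by auto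
      then show ?thesis by (simp add: trace_mscale idem_inverse_power_mult_le_one_iff[OF nz])
    qed
  qed (rule trace_add)
  then show "Tr D \<le> 1" by (simp add: Tr_def idem_sum_le_iff)
  have "row_col ?r (mpow D m *v g) \<le> 1" if m: "m < CARD('n)" for m
    unfolding D
  proof (rule additive_mpow_sum_le[where \<phi> = "\<lambda>X. row_col ?r (X *v g)"])
    fix k i :: nat and "is" :: "nat list"
    assume is_len: "length is = k" "k + i + sum_list is = m"
    show "row_col ?r (mscale (inverse ?\<theta> ^ k) (mpow B i ** alt_prod A B is) *v g) \<le> 1"
    proof (cases k)
      case 0
      then show ?thesis using is_len m gB by (simp add: mscale_one)
    next
      case (Suc l)
      then have "is \<noteq> []" using is_len by auto
      then have "row_col ?r ((mpow B i ** alt_prod A B is) *v g) \<le> ?\<theta> ^ k"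
        using is_len m word_le_theta(2)[of "is" i h C B A g]
        by (auto simp: row_col_vector_matrix)
      then show ?thesis
        by (simp add: mscale_mult_vector row_col_vsmult_right
            idem_inverse_power_mult_le_one_iff[OF nz])
    qed
  qed (simp add: matrix_vector_mult_add_rdistrib row_col_add_right)
  then show "row_col (?r v* star D) g \<le> 1" by (simp add: star_le)
qed

lemma mscale_inverse_add_mult_le_iff:
  fixes A B :: "'a::radicable_idem_semifield ^ 'n ^ 'n"
  assumes "t \<noteq> 0"
  shows "(mscale (inverse t) A + B) *v x \<le> x \<longleftrightarrow> A *v x \<le> t *s x \<and> B *v x \<le> x"
  by (simp add: matrix_vector_mult_add_rdistrib idem_vec_add_le_iff mscale_mult_vector)
    (simp add: less_eq_vec_def idem_inverse_mult_le_iff[OF assms])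

theorem theorem4:
  fixes A B :: "'a::radicable_idem_semifield ^ 'n ^ 'n"
    and C :: "'a ^ 'n ^ 'm"
    and g :: "'a ^ 'n"
    and h :: "'a ^ 'm"
    and \<theta> :: 'a
  assumes "spectral_rad A > 0"
    and "column_regular C"
    and "regular h"
    and "Tr B + row_col (conj_transpose h v* C v* star B) g \<le> 1"
    and \<theta>_def: "\<theta> = theta A B g C h"
  shows "(\<exists>x\<in>feasible_set B g C h. objective A x = \<theta>)
      \<and> (\<forall>x\<in>feasible_set B g C h. \<theta> \<le> objective A x)
      \<and> (\<forall>x\<in>feasible_set B g C h. objective A x = \<theta> \<longleftrightarrow>
      (\<exists>u. regular u \<and> g \<le> u
        \<and> u \<le> conj_transpose (conj_transpose h v* C v* star (mscale (inverse \<theta>) A + B))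
        \<and> x = star (mscale (inverse \<theta>) A + B) *v u))
      \<and> (\<forall>x u. regular u \<and> g \<le> u
        \<and> u \<le> conj_transpose (conj_transpose h v* C v* star (mscale (inverse \<theta>) A + B))
        \<and> x = star (mscale (inverse \<theta>) A + B) *v u
      \<longrightarrow> x \<in> feasible_set B g C h \<and> objective A x = \<theta>)"
proof -
  let ?D = "mscale (inverse \<theta>) A + B" and ?r = "conj_transpose h v* C"
  let ?F = "feasible_set B g C h"
  let ?sol = "\<lambda>u. regular u \<and> g \<le> u \<and> u \<le> conj_transpose (?r v* star ?D)"
  have nz: "\<theta> \<noteq> 0"
    using assms(1) spectral_rad_le_theta[of A B g C h] by (auto simp: \<theta>_def idem_zero_le leD)
  note D_le = Tr_and_row_col_star_scaled_le_one[OF assms(1,4), of ?D, folded \<theta>_def, OF refl]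
  have lower: "\<theta> \<le> objective A x" if "x \<in> ?F" for x
    using theta_le_objective[OF assms(3) that] by (simp add: \<theta>_def)
  have C_le: "C *v x \<le> h \<longleftrightarrow> row_col ?r x \<le> 1" for x
    using row_col_conj_transpose_le_iff[OF assms(3), of "C *v x" 1]
    by (simp add: row_col_vector_matrix)
  have "regular ?r"
    by (intro regular_vector_matrix regular_conj_transpose assms(2,3))
  \<comment> \<open>The star dominates the identity, so \<open>?r v* star ?D\<close> inherits
    regularity from \<open>?r\<close>.\<close>
  moreover have "?r \<le> ?r v* star ?D"
  proof -
    have "?r $ j * 1 \<le> (?r v* star ?D) $ j" for j
    proof -
      have "1 \<le> star ?D $ j $ j" using mpow_le_star[of 0 ?D j j] by (simp add: mat_def)
      then have "?r $ j * 1 \<le> ?r $ j * star ?D $ j $ j" by (rule idem_mult_mono_left)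
      also have "\<dots> \<le> (?r v* star ?D) $ j"
        unfolding vector_matrix_nth[of ?r]
        by (rule idem_le_sum[where f = "\<lambda>i. ?r $ i * star ?D $ i $ j"]) auto
      finally show ?thesis .
    qed
    then show ?thesis by (simp add: less_eq_vec_def)
  qed
  ultimately have reg: "regular (?r v* star ?D)" by (rule regular_mono)
  \<comment> \<open>The upper bound on \<open>u\<close> is the constraint
    \<open>C *v x \<le> h\<close> for \<open>x = star ?D *v u\<close>.\<close>
  have upper_iff: "u \<le> conj_transpose (?r v* star ?D) \<longleftrightarrow> row_col ?r (star ?D *v u) \<le> 1" for u
    using le_conj_transpose_iff[OF reg] by (simp add: row_col_vector_matrix)
  have sound: "star ?D *v u \<in> ?F \<and> objective A (star ?D *v u) = \<theta>" if u: "?sol u" for u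
  proof -
    let ?x = "star ?D *v u"
    have le: "u \<le> ?x" by (rule le_star_mult_vector)
    then have x: "regular ?x" "g \<le> ?x" using u by (auto intro: regular_mono order_trans)
    have ABx: "A *v ?x \<le> \<theta> *s ?x" "B *v ?x \<le> ?x"
      using mult_star_mult_vector_le[OF D_le(1), of u] mscale_inverse_add_mult_le_iff[OF nz]
      by blast+
    have F: "?x \<in> ?F"
      using x ABx u upper_iff C_le by (simp add: feasible_set_def idem_vec_add_le_iff)
    then show ?thesis using lower[OF F] objective_le_iff[OF x(1)] ABx(1) by force
  qed
  \<comment> \<open>An optimal \<open>x\<close> serves as its own parameter.\<close>
  have complete: "?sol x \<and> x = star ?D *v x" if F: "x \<in> ?F" and opt: "objective A x = \<theta>" for x
  proof -
    have x: "regular x" "B *v x \<le> x" "g \<le> x" "C *v x \<le> h"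
      using F by (auto simp: feasible_set_def idem_vec_add_le_iff)
    have "?D *v x \<le> x"
      using objective_le_iff[OF x(1), of A \<theta>] opt x(2)
      by (simp add: mscale_inverse_add_mult_le_iff[OF nz])
    then have "star ?D *v x = x" by (rule star_mult_vector_eq)
    then show ?thesis using x upper_iff C_le by simp
  qed
  \<comment> \<open>The witness is the upper end of the interval; \<open>D_le(2)\<close> says that
    \<open>g\<close> lies below it.\<close>
  have "?sol (conj_transpose (?r v* star ?D))"
    using regular_conj_transpose[OF reg] le_conj_transpose_iff[OF reg] D_le(2) by simp
  then have "\<exists>x\<in>?F. objective A x = \<theta>" using sound by blast
  with lower sound complete show ?thesis by blast
qed

end
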